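(* Put $E=C_2\times C_2\times C_6$ and $G=C_2\times C_{12}$. Then $$S_{\mathrm{odd}}(E)\subsetneq S_{\mathrm{odd}}(G).$$ For every integer $r\ge0$, $$D_r=3^4\cdot5\cdot13\cdot73^{\,r+1}\in S_{\mathrm{odd}}(G)\setminus S_{\mathrm{odd}}(E).$$
   Context: For a finite group $G$, $S(G)=\{\det(a_{gh^{-1}})_{g,h\in G}:a_g\in\mathbb Z\}$ is its integer group determinant set, and $S_{\mathrm{odd}}(G)$ is the set of odd members of $S(G)$. $C_n$ is the cyclic group of order $n$. *)

theory Defs
  imports "HOL-Analysis.Analysis"
begin

text \<open>
  A finite group is a type of class \<open>{finite, group_add}\<close>. This class does not assume
  commutativity; the group operation is written additively, so that \<open>g - h\<close> stands for
  \<open>g h\<^sup>-\<^sup>1\<close>. The rows and columns of a group matrix are indexed by the group elements.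
  The cyclic group of order \<open>n\<close> is the additive group of the numeral type \<open>n\<close> of
  \<^theory>\<open>HOL-Library.Numeral_Type\<close>, i.e. the residues \<open>0, \<dots>, n - 1\<close> modulo \<open>n\<close>, and
  direct products are product types with the componentwise operations.
\<close>

definition group_matrix :: "('g::{finite,group_add} \<Rightarrow> 'a) \<Rightarrow> (('a, 'g) vec, 'g) vec" where
  "group_matrix a = (\<chi> g h. a (g - h))"

definition group_det_set :: "'g::{finite,group_add} itself \<Rightarrow> int set" where
  "group_det_set _ = {det (group_matrix a) | a :: 'g \<Rightarrow> int. True}"

definition odd_group_det_set :: "'g::{finite,group_add} itself \<Rightarrow> int set" where
  "odd_group_det_set G = {d \<in> group_det_set G. odd d}"

end

theory Submission
  imports Defs
begin

text \<open>
  Write \<open>R\<close> for the integral group ring of \<open>C\<^sub>3\<close>. A group determinant of \<open>E = C\<^sub>2\<^sup>3 \<times> C\<^sub>3\<close> is the norm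
  from \<open>R\<close> of the product of the values in \<open>R\<close> at the eight characters of \<open>C\<^sub>2\<^sup>3\<close>. In any
  commutative ring this product is congruent modulo \<open>8\<close> to the eighth power of the augmentation
  \<open>\<epsilon>\<close>, and if the norm is odd then \<open>\<epsilon>\<close> is congruent modulo \<open>2\<close> to an element of \<open>C\<^sub>3\<close>. So every
  odd determinant of \<open>E\<close> is the norm of some \<open>1 + 8 t\<close>, which is also the determinant of
  \<open>1 + t \<Sigma>\<close> for \<open>G = C\<^sub>2 \<times> C\<^sub>4 \<times> C\<^sub>3\<close>, where \<open>\<Sigma>\<close> is the sum of the elements of \<open>C\<^sub>2 \<times> C\<^sub>4\<close>.

  If \<open>D\<^sub>r\<close> were the norm of \<open>1 + 8 t\<close>, then the value of \<open>1 + 8 t\<close> at a primitive cube root of unity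
  would be an Eisenstein integer of norm \<open>9 \<cdot> 73\<^sup>s\<close>, as one sees modulo \<open>8\<close> and from the primes \<open>3\<close>
  and \<open>5\<close>. Hence it would be congruent modulo \<open>8\<close> to \<open>3\<close> times one of the units \<open>\<plusminus>\<omega>\<^sup>j\<close>, and not to
  \<open>1\<close>. In \<open>G\<close> this obstruction disappears because \<open>C\<^sub>4\<close> has non-real characters.
\<close>

section \<open>Group determinants as products over characters\<close>

lemma det_of_int: "det (\<chi> i j. of_int (A $ i $ j)) = (of_int (det (A :: int ^ 'n ^ 'n)) :: 'a::comm_ring_1)"
  by (simp add: det_def)

text \<open>A nondegenerate bimultiplicative pairing identifies the group with its character group
  through \<open>k\<close> mapped to \<open>\<lambda>g. e g k\<close>, so that products over
  characters can be indexed by the group itself.\<close>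

definition group_pairing :: "('g::{finite,ab_group_add} \<Rightarrow> 'g \<Rightarrow> complex) \<Rightarrow> bool" where
  "group_pairing e \<longleftrightarrow>
    (\<forall>g h k. e (g + h) k = e g k * e h k) \<and>
    (\<forall>g k l. e g (k + l) = e g k * e g l) \<and>
    (\<forall>k. e 0 k = 1) \<and> (\<forall>k. k \<noteq> 0 \<longrightarrow> (\<exists>g. e g k \<noteq> 1))"

context
  fixes e :: "'g::{finite,ab_group_add} \<Rightarrow> 'g \<Rightarrow> complex"
  assumes e: "group_pairing e"
begin

lemma pairing_add_left: "e (g + h) k = e g k * e h k"
  and pairing_add_right: "e g (k + l) = e g k * e g l"
  and pairing_zero_left: "e 0 k = 1"
  using e by (auto simp: group_pairing_def)

lemma pairing_minus_left: "e g k * e (- g) k = 1"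
  using pairing_add_left[of g "- g" k] pairing_zero_left[of k] by simp

lemma pairing_zero_right: "e g 0 = 1"
proof -
  have "e g 0 = e g 0 * e g 0" using pairing_add_right[of g 0 0] by simp
  moreover have "e g 0 \<noteq> 0" using pairing_minus_left[of g 0] by auto
  ultimately show ?thesis by simp
qed

lemma pairing_minus_swap: "e (- g) k = e g (- k)"
proof -
  have "e g k * e g (- k) = 1"
    using pairing_add_right[of g k "- k"] pairing_zero_right[of g] by simp
  then have "e g k * e g (- k) = e g k * e (- g) k" using pairing_minus_left by simp
  moreover have "e g k \<noteq> 0" using pairing_minus_left[of g k] by auto
  ultimately show ?thesis by simp
qed

lemma pairing_orthogonal: "(\<Sum>g\<in>UNIV. e g k) = (if k = 0 then of_nat CARD('g) else 0)"
proof (cases "k = 0")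
  case False
  then obtain g where g: "e g k \<noteq> 1" using e by (auto simp: group_pairing_def)
  have "(\<Sum>h\<in>UNIV. e h k) = (\<Sum>h\<in>UNIV. e (g + h) k)"
    by (rule sum.reindex_bij_witness[of _ "\<lambda>h. g + h" "\<lambda>h. - g + h"]) auto
  also have "\<dots> = e g k * (\<Sum>h\<in>UNIV. e h k)"
    by (simp add: pairing_add_left sum_distrib_left)
  finally have "(1 - e g k) * (\<Sum>h\<in>UNIV. e h k) = 0" by (simp add: algebra_simps)
  with g False show ?thesis by simp
qed (simp add: pairing_zero_right)

text \<open>The character table \<open>W\<close> diagonalizes every group matrix: its column
  \<open>k\<close> is an eigenvector with eigenvalue \<open>L (- k)\<close>. Orthogonality, in the
  form \<open>V ** W\<close>, shows that \<open>W\<close> is invertible.\<close>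

lemma det_group_matrix_pairing:
  fixes a :: "'g \<Rightarrow> complex"
  shows "det (group_matrix a) = (\<Prod>k\<in>UNIV. \<Sum>g\<in>UNIV. a g * e g k)"
proof -
  define W where "W = (\<chi> g k. e g k)"
  define V where "V = (\<chi> k g. e g (- k))"
  define L where "L k = (\<Sum>g\<in>UNIV. a g * e g k)" for k
  have VW: "V ** W = (\<chi> k l. if k = l then of_nat CARD('g) else 0)"
  proof -
    have "(\<Sum>g\<in>UNIV. e g (- k) * e g l) = (if k = l then of_nat CARD('g) else 0)" for k l
    proof -
      have "- k + l = 0 \<longleftrightarrow> k = l" by (auto simp: add_eq_0_iff)
      then show ?thesis by (simp only: pairing_add_right[symmetric] pairing_orthogonal)
    qed
    then show ?thesis by (simp add: V_def W_def matrix_matrix_mult_def)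
  qed
  have "det (V ** W) = of_nat CARD('g) ^ CARD('g)"
    unfolding VW by (simp add: det_diagonal)
  then have "det V * det W = of_nat CARD('g) ^ CARD('g)"
    by (simp only: det_mul)
  then have W: "det W \<noteq> 0" by auto
  have "group_matrix a ** W = W ** (\<chi> k l. if k = l then L (- k) else 0)"
  proof -
    have "(\<Sum>h\<in>UNIV. a (g - h) * e h k) = e g k * L (- k)" for g k
    proof -
      have "(\<Sum>h\<in>UNIV. a (g - h) * e h k) = (\<Sum>u\<in>UNIV. a u * e (g - u) k)"
        by (rule sum.reindex_bij_witness[of _ "\<lambda>h. g - h" "\<lambda>h. g - h"]) auto
      also have "\<dots> = e g k * L (- k)"
        using pairing_add_left[of g "- u" k for u]
        by (simp add: L_def sum_distrib_left pairing_minus_swap ac_simps)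
      finally show ?thesis .
    qed
    moreover have "(\<Sum>l\<in>UNIV. e g l * (if l = k then L (- l) else 0)) = e g k * L (- k)" for g k
    proof -
      have "(\<Sum>l\<in>UNIV. e g l * (if l = k then L (- l) else 0))
          = (\<Sum>l\<in>UNIV. if l = k then e g l * L (- l) else 0)"
        by (rule sum.cong) auto
      then show ?thesis by simp
    qed
    ultimately show ?thesis
      by (simp only: group_matrix_def W_def matrix_matrix_mult_def vec_lambda_beta)
  qed
  then have "det (group_matrix a ** W) = det (W ** (\<chi> k l. if k = l then L (- k) else 0))"
    by (rule arg_cong)
  moreover have "det (\<chi> k l. if k = l then L (- k) else 0) = (\<Prod>k\<in>UNIV. L (- k))"
    by (simp add: det_diagonal)
  ultimately have "det (group_matrix a) * det W = det W * (\<Prod>k\<in>UNIV. L (- k))"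
    by (simp only: det_mul)
  then have "det (group_matrix a) = (\<Prod>k\<in>UNIV. L (- k))" using W by simp
  also have "\<dots> = (\<Prod>k\<in>UNIV. L k)"
    by (rule prod.reindex_bij_witness[of _ uminus uminus]) auto
  finally show ?thesis by (simp add: L_def)
qed

lemma det_int_group_matrix_pairing:
  fixes a :: "'g \<Rightarrow> int"
  shows "of_int (det (group_matrix a)) = (\<Prod>k\<in>UNIV. \<Sum>g\<in>UNIV. of_int (a g) * e g k)"
  by (simp add: det_group_matrix_pairing[symmetric] det_of_int[symmetric] group_matrix_def)

end

lemma group_pairing_prod:
  assumes "group_pairing e" "group_pairing e'"
  shows "group_pairing (\<lambda>g k. e (fst g) (fst k) * e' (snd g) (snd k))"
  unfolding group_pairing_def
proof (intro conjI allI impI)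
  fix k :: "'a \<times> 'b" assume "k \<noteq> 0"
  then consider "fst k \<noteq> 0" | "snd k \<noteq> 0" by (auto simp: prod_eq_iff)
  then show "\<exists>g. e (fst g) (fst k) * e' (snd g) (snd k) \<noteq> 1"
  proof cases
    case 1
    then obtain g where "e g (fst k) \<noteq> 1" using assms by (auto simp: group_pairing_def)
    then show ?thesis using pairing_zero_left[OF assms(2)] by (intro exI[of _ "(g, 0)"]) simp
  next
    case 2
    then obtain g where "e' g (snd k) \<noteq> 1" using assms by (auto simp: group_pairing_def)
    then show ?thesis using pairing_zero_left[OF assms(1)] by (intro exI[of _ "(0, g)"]) simp
  qed
qed (use assms in \<open>auto simp: group_pairing_def\<close>)

section \<open>Characters of cyclic groups of even order\<close>

definition residue :: "'n::finite bit0 \<Rightarrow> nat" where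
  "residue x = nat (Rep_bit0 x)"

lemma Rep_bit0_nonneg: "0 \<le> Rep_bit0 x"
  using Rep_bit0[of x] by simp

lemma residue_less: "residue (x :: 'n::finite bit0) < CARD('n bit0)"
  using bit0.Rep_less_n[of x] by (simp add: residue_def nat_less_iff Rep_bit0_nonneg)

lemma residue_0: "residue 0 = 0"
  by (simp add: residue_def bit0.Rep_0)

lemma residue_1: "residue 1 = 1"
  by (simp add: residue_def bit0.Rep_1)

lemma residue_add: "residue (x + y :: 'n::finite bit0) = (residue x + residue y) mod CARD('n bit0)"
  by (simp add: residue_def bit0.add_def bit0.Rep_Abs_mod Rep_bit0_nonneg nat_mod_distrib
      nat_add_distrib nat_mult_distrib del: card_bit0)

lemma residue_of_nat: "residue (of_nat k :: 'n::finite bit0) = k mod CARD('n bit0)"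
  by (simp add: residue_def bit0.of_nat_eq bit0.Rep_Abs_mod nat_mod_distrib del: card_bit0)

lemma of_nat_residue: "of_nat (residue x) = x"
  by (metis bit0.Rep_inverse bit0.Rep_mod bit0.of_nat_eq Rep_bit0_nonneg residue_def int_nat_eq)

lemma bij_betw_of_nat_bit0:
  "bij_betw (of_nat :: nat \<Rightarrow> 'n::finite bit0) {..<CARD('n bit0)} UNIV"
  by (rule bij_betwI[where g = residue])
    (auto simp: residue_of_nat of_nat_residue residue_less simp del: card_bit0)

lemma sum_bit0: "(\<Sum>x\<in>UNIV. f x) = (\<Sum>k<CARD('n bit0). f (of_nat k :: 'n::finite bit0))"
  by (rule sum.reindex_bij_betw[symmetric, OF bij_betw_of_nat_bit0])

lemma prod_bit0: "(\<Prod>x\<in>UNIV. f x) = (\<Prod>k<CARD('n bit0). f (of_nat k :: 'n::finite bit0))"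
  by (rule prod.reindex_bij_betw[symmetric, OF bij_betw_of_nat_bit0])

lemma power_mod_exponent: "(z :: 'a::monoid_mult) ^ n = 1 \<Longrightarrow> z ^ (m mod n) = z ^ m"
  by (metis div_mult_mod_eq mult.left_neutral mult.commute power_add power_mult power_one)

text \<open>The hypotheses say that \<open>z\<close> is a primitive root of unity of order n.
  Testing against the generator \<open>1\<close> already gives nondegeneracy.\<close>

lemma group_pairing_bit0:
  fixes z :: complex
  assumes "z ^ CARD('n bit0) = 1" "\<And>k. 0 < k \<Longrightarrow> k < CARD('n bit0) \<Longrightarrow> z ^ k \<noteq> 1"
  shows "group_pairing (\<lambda>g k :: 'n::finite bit0. z ^ (residue g * residue k))"
proof -
  have 1: "z ^ (x mod CARD('n bit0) * y) = z ^ (x * y)" for x y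
    using power_mod_exponent[OF assms(1), of "x mod CARD('n bit0) * y"]
      power_mod_exponent[OF assms(1), of "x * y"] by (metis mod_mult_left_eq)
  have 2: "z ^ (y * (x mod CARD('n bit0))) = z ^ (y * x)" for x y
    using 1[of x y] by (simp add: mult.commute)
  have 3: "residue k \<noteq> 0" if "k \<noteq> 0" for k :: "'n bit0"
    using that of_nat_residue[of k] by (metis of_nat_0)
  have 4: "\<exists>g :: 'n bit0. z ^ (residue g * residue k) \<noteq> 1" if "k \<noteq> 0" for k :: "'n bit0"
    using assms(2)[OF _ residue_less, of k] 3[OF that]
    by (intro exI[of _ 1]) (simp add: residue_1)
  show ?thesis unfolding group_pairing_def residue_add 1 2
    using 4 by (auto simp: residue_0 power_add algebra_simps)
qed

section \<open>The integral group ring of \<open>C\<^sub>3\<close>\<close>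

text \<open>The integral group ring of \<open>C\<^sub>3\<close>: \<open>C3 a b c\<close> stands for \<open>a + b z + c z\<^sup>2\<close> with \<open>z\<^sup>3 = 1\<close>.
  The group determinant of \<open>C\<^sub>3\<close> is the norm, i.e. the value at \<open>z = 1\<close> times the norm of the value
  at \<open>z = \<omega>\<close>.\<close>

datatype c3_ring = C3 (c3_0: int) (c3_1: int) (c3_2: int)

lemma c3_ring_eq_iff: "x = y \<longleftrightarrow> c3_0 x = c3_0 y \<and> c3_1 x = c3_1 y \<and> c3_2 x = c3_2 y"
  by (cases x; cases y) simp

instantiation c3_ring :: comm_ring_1
begin

definition zero_c3_ring :: c3_ring where "0 = C3 0 0 0"
definition one_c3_ring :: c3_ring where "1 = C3 1 0 0"
definition plus_c3_ring :: "c3_ring \<Rightarrow> c3_ring \<Rightarrow> c3_ring" where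
  "x + y = C3 (c3_0 x + c3_0 y) (c3_1 x + c3_1 y) (c3_2 x + c3_2 y)"
definition minus_c3_ring :: "c3_ring \<Rightarrow> c3_ring \<Rightarrow> c3_ring" where
  "x - y = C3 (c3_0 x - c3_0 y) (c3_1 x - c3_1 y) (c3_2 x - c3_2 y)"
definition uminus_c3_ring :: "c3_ring \<Rightarrow> c3_ring" where
  "- x = C3 (- c3_0 x) (- c3_1 x) (- c3_2 x)"
definition times_c3_ring :: "c3_ring \<Rightarrow> c3_ring \<Rightarrow> c3_ring" where
  "x * y = C3 (c3_0 x * c3_0 y + c3_1 x * c3_2 y + c3_2 x * c3_1 y)
              (c3_0 x * c3_1 y + c3_1 x * c3_0 y + c3_2 x * c3_2 y)
              (c3_0 x * c3_2 y + c3_1 x * c3_1 y + c3_2 x * c3_0 y)"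

instance
  by standard (auto simp: zero_c3_ring_def one_c3_ring_def plus_c3_ring_def minus_c3_ring_def
      uminus_c3_ring_def times_c3_ring_def c3_ring_eq_iff algebra_simps)

end

lemmas c3_ring_defs = zero_c3_ring_def one_c3_ring_def plus_c3_ring_def minus_c3_ring_def
  uminus_c3_ring_def times_c3_ring_def

lemma of_nat_c3_ring: "of_nat n = C3 (int n) 0 0"
  by (induction n) (simp_all add: c3_ring_defs)

lemma numeral_c3_ring: "numeral n = C3 (numeral n) 0 0"
  by (metis of_nat_c3_ring of_nat_numeral)

definition c3_norm :: "c3_ring \<Rightarrow> int" where
  "c3_norm x = c3_0 x ^ 3 + c3_1 x ^ 3 + c3_2 x ^ 3 - 3 * c3_0 x * c3_1 x * c3_2 x"

lemma c3_norm_C3: "c3_norm (C3 a b c) = a ^ 3 + b ^ 3 + c ^ 3 - 3 * a * b * c"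
  by (simp add: c3_norm_def)

lemma c3_norm_one: "c3_norm 1 = 1"
  by (simp add: c3_norm_def one_c3_ring_def)

definition c3_eval :: "complex \<Rightarrow> c3_ring \<Rightarrow> complex" where
  "c3_eval w x = of_int (c3_0 x) + of_int (c3_1 x) * w + of_int (c3_2 x) * w ^ 2"

lemma c3_eval_add: "c3_eval w (x + y) = c3_eval w x + c3_eval w y"
  by (simp add: c3_eval_def plus_c3_ring_def algebra_simps)

lemma c3_eval_diff: "c3_eval w (x - y) = c3_eval w x - c3_eval w y"
  by (simp add: c3_eval_def minus_c3_ring_def algebra_simps)

lemma c3_eval_mult:
  assumes "w ^ 3 = 1"
  shows "c3_eval w (x * y) = c3_eval w x * c3_eval w y"
proof -
  \<comment> \<open>Multiplication in the ring is multiplication of polynomials reduced modulo z^3 -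
    1; the two correction terms undo the reduction of z^3 and z^4.\<close>
  have "c3_eval w (x * y) = c3_eval w x * c3_eval w y
      - (w ^ 3 - 1) * of_int (c3_1 x * c3_2 y + c3_2 x * c3_1 y)
      - (w ^ 3 - 1) * w * of_int (c3_2 x * c3_2 y)"
    by (simp add: c3_eval_def times_c3_ring_def algebra_simps power2_eq_square power3_eq_cube)
  then show ?thesis using assms by simp
qed

definition omega :: complex where "omega = Complex (- 1 / 2) (sqrt 3 / 2)"

lemma omega_square: "omega ^ 2 = - 1 - omega"
  by (simp add: omega_def power2_eq_square complex_eq_iff)

lemma omega_cube: "omega ^ 3 = 1"
proof -
  have "omega ^ 3 = omega * omega ^ 2" by (simp add: power3_eq_cube power2_eq_square)
  also have "\<dots> = - omega - omega ^ 2" by (simp only: omega_square) (simp add: algebra_simps omega_square flip: power2_eq_square)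
  also have "\<dots> = 1" by (simp add: omega_square)
  finally show ?thesis .
qed

lemma omega_neq: "omega \<noteq> 1" "omega ^ 2 \<noteq> 1" "omega ^ 2 \<noteq> omega"
  by (auto simp: omega_square) (auto simp: omega_def complex_eq_iff)

lemma omega_mult: "(p + q * omega) * (r + s * omega) = p * r - q * s + (p * s + q * r - q * s) * omega"
proof -
  have "(p + q * omega) * (r + s * omega) = p * r + (p * s + q * r) * omega + q * s * omega ^ 2"
    by (simp add: algebra_simps power2_eq_square)
  also have "\<dots> = p * r - q * s + (p * s + q * r - q * s) * omega"
    by (simp only: omega_square) (simp add: algebra_simps)
  finally show ?thesis .
qed

definition c3_aug :: "c3_ring \<Rightarrow> int" where
  "c3_aug x = c3_0 x + c3_1 x + c3_2 x"

text \<open>Norm of the Eisenstein integer a + b omega + c omega^2 = (a - c) + (b - c) omega, in the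
  basis 1, omega.\<close>

definition c3_quad :: "c3_ring \<Rightarrow> int" where
  "c3_quad x = (c3_0 x - c3_2 x)\<^sup>2 - (c3_0 x - c3_2 x) * (c3_1 x - c3_2 x) + (c3_1 x - c3_2 x)\<^sup>2"

lemma c3_norm_eq: "c3_norm x = c3_aug x * c3_quad x"
  by (simp add: c3_norm_def c3_aug_def c3_quad_def algebra_simps power2_eq_square power3_eq_cube)

lemma c3_aug_add: "c3_aug (x + y) = c3_aug x + c3_aug y"
  by (simp add: c3_aug_def plus_c3_ring_def)

lemma c3_aug_mult: "c3_aug (x * y) = c3_aug x * c3_aug y"
  by (simp add: c3_aug_def times_c3_ring_def algebra_simps)

lemma c3_eval_1: "c3_eval 1 x = of_int (c3_aug x)"
  by (simp add: c3_eval_def c3_aug_def)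

lemma c3_quad_eval: "of_int (c3_quad x) = c3_eval omega x * c3_eval (omega ^ 2) x"
proof -
  define a b c :: complex where "a = of_int (c3_0 x)" and "b = of_int (c3_1 x)" and "c = of_int (c3_2 x)"
  have "omega ^ 4 = omega * omega ^ 3" by (simp add: numeral_eq_Suc)
  then have 4: "(omega ^ 2) ^ 2 = omega" by (simp add: omega_cube flip: power_mult)
  have "c3_eval omega x = (a - c) + (b - c) * omega"
    by (simp add: c3_eval_def a_def b_def c_def omega_square algebra_simps)
  moreover have "c3_eval (omega ^ 2) x = (a - b) + (c - b) * omega"
    unfolding c3_eval_def 4 by (simp add: a_def b_def c_def omega_square algebra_simps)
  ultimately have "c3_eval omega x * c3_eval (omega ^ 2) x = (a - c)\<^sup>2 - (a - c) * (b - c) + (b - c)\<^sup>2"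
    by (simp only: omega_mult) (simp add: algebra_simps power2_eq_square)
  then show ?thesis
    by (simp add: c3_quad_def a_def b_def c_def)
qed

lemma c3_norm_eval:
  "of_int (c3_norm x) = c3_eval 1 x * c3_eval omega x * c3_eval (omega ^ 2) x"
  by (simp add: c3_norm_eq c3_quad_eval c3_eval_1 mult.assoc)

lemma omega_square_cube: "(omega ^ 2) ^ 3 = 1"
proof -
  have "(omega ^ 2) ^ 3 = (omega ^ 3) ^ 2" by (simp flip: power_mult)
  then show ?thesis by (simp add: omega_cube)
qed

lemma c3_quad_mult: "c3_quad (x * y) = c3_quad x * c3_quad y"
proof -
  have "(of_int (c3_quad (x * y)) :: complex) = of_int (c3_quad x * c3_quad y)"
    unfolding c3_quad_eval of_int_mult c3_eval_mult[OF omega_cube] c3_eval_mult[OF omega_square_cube]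
    by (rule mult.assoc[THEN trans]) (simp only: ac_simps)
  then show ?thesis by (simp only: of_int_eq_iff)
qed

lemma c3_norm_mult: "c3_norm (x * y) = c3_norm x * c3_norm y"
  by (simp add: c3_norm_eq c3_aug_mult c3_quad_mult)

lemma c3_norm_power: "c3_norm (x ^ n) = c3_norm x ^ n"
  by (induction n) (simp_all add: c3_norm_one c3_norm_mult)

lemma c3_quad_power: "c3_quad (x ^ n) = c3_quad x ^ n"
  by (induction n) (simp_all add: c3_quad_mult, simp add: c3_quad_def one_c3_ring_def)

section \<open>Products over the characters of \<open>C\<^sub>2\<^sup>3\<close> modulo \<open>8\<close>\<close>

text \<open>Modulo 8, a product of n factors A - 2 s is A^n - 2 A^(n-1) e + 4 A^(n-2) f with e, f
  the first two elementary symmetric functions of the s. Multiplying two such products keeps this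
  shape with A^2 in the place of A, so the step can be iterated.\<close>

lemma eight_dvd_sign_product_step:
  fixes A :: "'a::comm_ring_1"
  assumes "8 dvd X - (A ^ 2 - 2 * A * e + 4 * f)" "8 dvd Y - (A ^ 2 - 2 * A * e' + 4 * f')"
  shows "8 dvd X * Y - ((A ^ 2) ^ 2 - 2 * A ^ 2 * (A * (e + e')) + 4 * (A ^ 2 * (f + f' + e * e')))"
proof -
  define P Q R where "P = A ^ 2 - 2 * A * e + 4 * f" and "Q = A ^ 2 - 2 * A * e' + 4 * f'"
    and "R = (A ^ 2) ^ 2 - 2 * A ^ 2 * (A * (e + e')) + 4 * (A ^ 2 * (f + f' + e * e'))"
  have "P * Q - R = 8 * (2 * f * f' - A * e * f' - A * e' * f)"
    by (simp add: P_def Q_def R_def algebra_simps power2_eq_square)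
  then have "8 dvd P * Q - R" by (rule dvdI)
  moreover have "8 dvd (X - P) * Y" "8 dvd P * (Y - Q)"
    using assms by (simp_all add: P_def Q_def)
  ultimately have "8 dvd (X - P) * Y + P * (Y - Q) + (P * Q - R)" by simp
  moreover have "(X - P) * Y + P * (Y - Q) + (P * Q - R) = X * Y - R"
    by (simp add: algebra_simps)
  ultimately show ?thesis by (simp only: R_def)
qed

lemma eight_dvd_product_augmentation_minus:
  fixes S :: "'a::comm_ring_1"
  assumes e: "s1 + s2 + s3 + s4 + s5 + s6 + s7 = 4 * C"
    and f: "s2 * s3 + s1 * (s2 + s3) + (s4 * s5 + s6 * s7 + (s4 + s5) * (s6 + s7))
      + (s1 + (s2 + s3)) * (s4 + s5 + (s6 + s7)) = 2 * q"
  shows "8 dvd S * (S - 2 * s1) * ((S - 2 * s2) * (S - 2 * s3))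
    * ((S - 2 * s4) * (S - 2 * s5) * ((S - 2 * s6) * (S - 2 * s7))) - S ^ 8"
proof -
  have T: "8 dvd (S - 2 * a) * (S - 2 * b) - (S ^ 2 - 2 * S * (a + b) + 4 * (a * b))" for a b
    by (simp add: algebra_simps power2_eq_square)
  \<comment> \<open>The eight factors are combined in pairs, then fours, then all together; the
    value 0 belongs to the trivial character.\<close>
  note D = eight_dvd_sign_product_step[OF eight_dvd_sign_product_step[OF T[of 0 s1] T[of s2 s3]]
      eight_dvd_sign_product_step[OF T[of s4 s5] T[of s6 s7]]]
  have E: "S * (0 + s1 + (s2 + s3)) + S * (s4 + s5 + (s6 + s7)) = S * (4 * C)"
    using arg_cong[OF e, of "\<lambda>x. S * x"] by (simp add: algebra_simps)
  have "S ^ 2 * (0 * s1 + s2 * s3 + (0 + s1) * (s2 + s3))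
      + S ^ 2 * (s4 * s5 + s6 * s7 + (s4 + s5) * (s6 + s7))
      + S * (0 + s1 + (s2 + s3)) * (S * (s4 + s5 + (s6 + s7)))
    = S ^ 2 * (s2 * s3 + s1 * (s2 + s3) + (s4 * s5 + s6 * s7 + (s4 + s5) * (s6 + s7))
      + (s1 + (s2 + s3)) * (s4 + s5 + (s6 + s7)))"
    by (simp add: algebra_simps power2_eq_square)
  then have F: "S ^ 2 * (0 * s1 + s2 * s3 + (0 + s1) * (s2 + s3))
      + S ^ 2 * (s4 * s5 + s6 * s7 + (s4 + s5) * (s6 + s7))
      + S * (0 + s1 + (s2 + s3)) * (S * (s4 + s5 + (s6 + s7))) = S ^ 2 * (2 * q)"
    by (simp only: f)
  have "8 dvd 2 * (S ^ 2) ^ 2 * ((S ^ 2) * (S * (4 * C))) - 4 * ((S ^ 2) ^ 2 * (S ^ 2 * (2 * q)))"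
    by (intro dvdI[where k = "(S ^ 2) ^ 2 * (S ^ 2 * (S * C - q))"]) (simp add: algebra_simps)
  moreover have "8 dvd x - (z - u + v) \<Longrightarrow> 8 dvd u - v \<Longrightarrow> 8 dvd x - z" for x z u v :: 'a
    using dvd_diff[of 8 "x - (z - u + v)" "u - v"] by simp
  ultimately have "8 dvd (S - 2 * 0) * (S - 2 * s1) * ((S - 2 * s2) * (S - 2 * s3))
    * ((S - 2 * s4) * (S - 2 * s5) * ((S - 2 * s6) * (S - 2 * s7))) - ((S ^ 2) ^ 2) ^ 2"
    using D[unfolded E F] by blast
  then show ?thesis by (simp flip: power_mult)
qed

text \<open>The eight factors are the values of an element of the group ring of \<open>C\<^sub>2\<^sup>3\<close> at the characters.
  Writing them as \<open>S - 2 s\<close>, where \<open>S\<close> is the augmentation, the first two elementary symmetric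
  functions of the values \<open>s\<close> are divisible by \<open>4\<close> and \<open>2\<close>.\<close>

lemma eight_dvd_sign_product:
  fixes c0 :: "'a::comm_ring_1"
  shows "8 dvd (c0 + c1 + c2 + c3 + c4 + c5 + c6 + c7) * (c0 - c1 + c2 - c3 + c4 - c5 + c6 - c7)
    * ((c0 + c1 - c2 - c3 + c4 + c5 - c6 - c7) * (c0 - c1 - c2 + c3 + c4 - c5 - c6 + c7))
    * ((c0 + c1 + c2 + c3 - c4 - c5 - c6 - c7) * (c0 - c1 + c2 - c3 - c4 + c5 - c6 + c7)
    * ((c0 + c1 - c2 - c3 - c4 - c5 + c6 + c7) * (c0 - c1 - c2 + c3 - c4 + c5 + c6 - c7)))
    - (c0 + c1 + c2 + c3 + c4 + c5 + c6 + c7) ^ 8"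
proof -
  define S where "S = c0 + c1 + c2 + c3 + c4 + c5 + c6 + c7"
  have vals: "c0 + c1 + c2 + c3 + c4 + c5 + c6 + c7 = S"
    "c0 - c1 + c2 - c3 + c4 - c5 + c6 - c7 = S - 2 * (c1 + c3 + c5 + c7)"
    "c0 + c1 - c2 - c3 + c4 + c5 - c6 - c7 = S - 2 * (c2 + c3 + c6 + c7)"
    "c0 - c1 - c2 + c3 + c4 - c5 - c6 + c7 = S - 2 * (c1 + c2 + c5 + c6)"
    "c0 + c1 + c2 + c3 - c4 - c5 - c6 - c7 = S - 2 * (c4 + c5 + c6 + c7)"
    "c0 - c1 + c2 - c3 - c4 + c5 - c6 + c7 = S - 2 * (c1 + c3 + c4 + c6)"
    "c0 + c1 - c2 - c3 - c4 - c5 + c6 + c7 = S - 2 * (c2 + c3 + c4 + c5)"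
    "c0 - c1 - c2 + c3 - c4 + c5 + c6 - c7 = S - 2 * (c1 + c2 + c4 + c7)"
    unfolding S_def by (simp_all add: algebra_simps)
  show ?thesis unfolding vals
  proof (rule eight_dvd_product_augmentation_minus)
    show "(c1 + c3 + c5 + c7) + (c2 + c3 + c6 + c7) + (c1 + c2 + c5 + c6) + (c4 + c5 + c6 + c7)
        + (c1 + c3 + c4 + c6) + (c2 + c3 + c4 + c5) + (c1 + c2 + c4 + c7)
      = 4 * (c1 + c2 + c3 + c4 + c5 + c6 + c7)"
      by (simp add: algebra_simps power2_eq_square)
    show "(c2 + c3 + c6 + c7) * (c1 + c2 + c5 + c6)
        + (c1 + c3 + c5 + c7) * ((c2 + c3 + c6 + c7) + (c1 + c2 + c5 + c6))
        + ((c4 + c5 + c6 + c7) * (c1 + c3 + c4 + c6) + (c2 + c3 + c4 + c5) * (c1 + c2 + c4 + c7)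
          + ((c4 + c5 + c6 + c7) + (c1 + c3 + c4 + c6)) * ((c2 + c3 + c4 + c5) + (c1 + c2 + c4 + c7)))
        + ((c1 + c3 + c5 + c7) + ((c2 + c3 + c6 + c7) + (c1 + c2 + c5 + c6)))
          * ((c4 + c5 + c6 + c7) + (c1 + c3 + c4 + c6) + ((c2 + c3 + c4 + c5) + (c1 + c2 + c4 + c7)))
      = 2 * (4 * (c1 + c2 + c3 + c4 + c5 + c6 + c7) ^ 2
        - (c1 ^ 2 + c2 ^ 2 + c3 ^ 2 + c4 ^ 2 + c5 ^ 2 + c6 ^ 2 + c7 ^ 2)
        - (c1 * (c2 + c3 + c4 + c5 + c6 + c7) + c2 * (c3 + c4 + c5 + c6 + c7)
          + c3 * (c4 + c5 + c6 + c7) + c4 * (c5 + c6 + c7) + c5 * (c6 + c7) + c6 * c7))"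
      by (simp add: algebra_simps power2_eq_square)
  qed
qed

section \<open>Norms of Eisenstein integers\<close>

text \<open>The prime 73 splits as the norm of 9 + omega, so x + y omega is u + v omega times 9 +
  omega or times its conjugate 8 - omega.\<close>

lemma eisenstein_norm_step:
  fixes x y :: int
  assumes "73 dvd x\<^sup>2 - x * y + y\<^sup>2"
  obtains u v where "x\<^sup>2 - x * y + y\<^sup>2 = 73 * (u\<^sup>2 - u * v + v\<^sup>2)" "x = 9 * u - v" "y = u + 8 * v"
  | u v where "x\<^sup>2 - x * y + y\<^sup>2 = 73 * (u\<^sup>2 - u * v + v\<^sup>2)" "x = 8 * u + v" "y = 9 * v - u"
proof -
  \<comment> \<open>9 and -8 are the roots of T^2 - T + 1 modulo 73.\<close>
  have "x\<^sup>2 - x * y + y\<^sup>2 = (x - 9 * y) * (x + 8 * y) + 73 * y\<^sup>2"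
    by (simp add: algebra_simps power2_eq_square)
  with assms have "73 dvd (x - 9 * y) * (x + 8 * y)"
    by (simp add: dvd_add_left_iff)
  moreover have "prime (73 :: int)" by simp
  ultimately consider "73 dvd x - 9 * y" | "73 dvd x + 8 * y"
    using prime_dvd_mult_iff by blast
  then show ?thesis
  proof cases
    case 1
    then obtain k where "x - 9 * y = 73 * k" ..
    then have x: "x = 9 * y + 73 * k" by simp
    show ?thesis
      by (rule that(1)[of "y + 8 * k" "- k"]) (simp_all add: x algebra_simps power2_eq_square)
  next
    case 2
    then obtain k where "x + 8 * y = 73 * k" ..
    then have x: "x = 73 * k - 8 * y" by simp
    show ?thesis
      by (rule that(2)[of "9 * k - y" k]) (simp_all add: x algebra_simps power2_eq_square)
  qed
qed

lemma eisenstein_norm_1: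
  fixes x y :: int
  assumes "x\<^sup>2 - x * y + y\<^sup>2 = 1"
  shows "\<bar>y\<bar> \<le> 1"
proof (rule ccontr)
  assume "\<not> \<bar>y\<bar> \<le> 1"
  then have "2\<^sup>2 \<le> \<bar>y\<bar>\<^sup>2" by (intro power_mono) auto
  moreover have "(2 * x - y)\<^sup>2 + 3 * y\<^sup>2 = 4 * (x\<^sup>2 - x * y + y\<^sup>2)"
    by (simp add: algebra_simps power2_eq_square)
  moreover have "0 \<le> (2 * x - y)\<^sup>2" by simp
  ultimately show False using assms by simp
qed

text \<open>Elements of norm a power of \<open>73\<close> are products of units and of \<open>9 + \<omega>\<close> and its conjugate,
  both of which are units modulo \<open>8\<close>.\<close>

lemma eisenstein_norm_power_73:
  fixes x y :: int
  assumes "x\<^sup>2 - x * y + y\<^sup>2 = 73 ^ s"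
  shows "(x mod 8, y mod 8) \<in> {(1, 0), (7, 0), (0, 1), (0, 7), (1, 1), (7, 7)}"
  using assms
proof (induction s arbitrary: x y)
  case 0
  have "\<bar>y\<bar> \<le> 1" "\<bar>x\<bar> \<le> 1"
    using eisenstein_norm_1[of x y] eisenstein_norm_1[of y x] 0 by (auto simp: algebra_simps)
  then have "x \<in> {-1, 0, 1}" "y \<in> {-1, 0, 1}" by auto
  then show ?case using 0 by - (elim insertE emptyE; simp)
next
  case (Suc s)
  then have "73 dvd x\<^sup>2 - x * y + y\<^sup>2" by simp
  then show ?case
  proof (cases rule: eisenstein_norm_step)
    case (1 u v)
    have "u\<^sup>2 - u * v + v\<^sup>2 = 73 ^ s" using 1(1) Suc.prems by simp
    note IH = Suc.IH[OF this]
    define p q where pq: "p = u mod 8" "q = v mod 8"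
    have mem: "(p, q) \<in> {(1, 0), (7, 0), (0, 1), (0, 7), (1, 1), (7, 7)}"
      using IH by (simp only: pq)
    \<comment> \<open>Modulo 8 this is multiplication by 1 + omega = - omega^2, which permutes the
      six units; in the other case the factor is - omega.\<close>
    have eqs: "x mod 8 = (p - q) mod 8" "y mod 8 = p"
    proof -
      have "x = (u - v) + 8 * u" "y = u + 8 * v" using 1(2,3) by simp_all
      then show "x mod 8 = (p - q) mod 8" "y mod 8 = p"
        by (simp_all only: pq mod_diff_eq mod_mult_self2)
    qed
    show ?thesis unfolding eqs using mem by auto
  next
    case (2 u v)
    have "u\<^sup>2 - u * v + v\<^sup>2 = 73 ^ s" using 2(1) Suc.prems by simp
    note IH = Suc.IH[OF this]
    define p q where pq: "p = u mod 8" "q = v mod 8"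
    have mem: "(p, q) \<in> {(1, 0), (7, 0), (0, 1), (0, 7), (1, 1), (7, 7)}"
      using IH by (simp only: pq)
    have eqs: "x mod 8 = q" "y mod 8 = (q - p) mod 8"
    proof -
      have "x = v + 8 * u" "y = (v - u) + 8 * v" using 2(2,3) by simp_all
      then show "x mod 8 = q" "y mod 8 = (q - p) mod 8"
        by (simp_all only: pq mod_diff_eq mod_mult_self2)
    qed
    show ?thesis unfolding eqs using mem by auto
  qed
qed

text \<open>The prime 5 is inert in the Eisenstein integers: the form has no nontrivial zero modulo
  5.\<close>

lemma five_dvd_eisenstein_norm:
  fixes x y :: int
  assumes "5 dvd x\<^sup>2 - x * y + y\<^sup>2"
  shows "25 dvd x\<^sup>2 - x * y + y\<^sup>2"
proof -
  define i j where "i = x mod 5" and "j = y mod 5"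
  have "x = 5 * (x div 5) + i" "y = 5 * (y div 5) + j" by (simp_all add: i_def j_def)
  then obtain u v where uv: "x = 5 * u + i" "y = 5 * v + j" by blast
  have "x\<^sup>2 - x * y + y\<^sup>2
      = 5 * (5 * u\<^sup>2 + 2 * u * i - 5 * u * v - u * j - v * i + 5 * v\<^sup>2 + 2 * v * j) + (i\<^sup>2 - i * j + j\<^sup>2)"
    by (simp add: uv algebra_simps power2_eq_square)
  with assms have "5 dvd i\<^sup>2 - i * j + j\<^sup>2" by (simp add: dvd_add_right_iff)
  moreover have "i \<in> {0, 1, 2, 3, 4}" "j \<in> {0, 1, 2, 3, 4}"
    unfolding i_def j_def insert_iff empty_iff by presburger+
  ultimately have "i = 0" "j = 0" by auto
  with uv have "x = 5 * u" "y = 5 * v" by simp_all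
  then show ?thesis by (intro dvdI[of _ _ "u\<^sup>2 - u * v + v\<^sup>2"]) (simp add: algebra_simps power2_eq_square)
qed

text \<open>Up to a unit 3 is the square of 1 - omega, an element of norm 3, so a norm divisible by
  9 forces divisibility by 3.\<close>

lemma nine_dvd_eisenstein_norm:
  fixes x y :: int
  assumes "9 dvd x\<^sup>2 - x * y + y\<^sup>2" "3 dvd x + y"
  shows "3 dvd x" "3 dvd y"
proof -
  from assms(2) obtain k where "x + y = 3 * k" ..
  then have y: "y = 3 * k - x" by simp
  have "x\<^sup>2 - x * y + y\<^sup>2 = 3 * x\<^sup>2 + 9 * (k\<^sup>2 - k * x)"
    by (simp add: y algebra_simps power2_eq_square)
  with assms(1) have "9 dvd 3 * x\<^sup>2" by (simp add: dvd_add_left_iff)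
  then have "3 dvd x\<^sup>2" by presburger
  then show "3 dvd x" using prime_dvd_power[of 3 x 2] by simp
  then show "3 dvd y" unfolding y by simp
qed

section \<open>Excluding the numbers D_r as norms of elements 1 + 8 t\<close>

lemma dvd_primes_3_5_13_73_cases:
  fixes n :: nat
  assumes "n dvd 3 ^ 4 * 5 * 13 * 73 ^ m"
  obtains i j k s where "n = 3 ^ i * 5 ^ j * 13 ^ k * 73 ^ s" "i \<le> 4" "j \<le> 1" "k \<le> 1" "s \<le> m"
proof -
  from assms obtain b d where bd: "n = b * d" "b dvd 3 ^ 4 * 5 * 13" "d dvd 73 ^ m"
    using division_decomp by metis
  from bd(2) obtain b' b13 where b': "b = b' * b13" "b' dvd 3 ^ 4 * 5" "b13 dvd 13"
    using division_decomp by metis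
  from b'(2) obtain b3 b5 where b3: "b' = b3 * b5" "b3 dvd 3 ^ 4" "b5 dvd 5"
    using division_decomp by metis
  have p: "prime (3::nat)" "prime (5::nat)" "prime (13::nat)" "prime (73::nat)" by simp_all
  obtain s where "d = 73 ^ s" "s \<le> m" using bd(3) divides_primepow_nat[OF p(4)] by blast
  moreover obtain i where "b3 = 3 ^ i" "i \<le> 4" using b3(2) divides_primepow_nat[OF p(1)] by blast
  moreover obtain j where "b5 = 5 ^ j" "j \<le> 1"
    using b3(3) divides_primepow_nat[OF p(2), of b5 1] by auto
  moreover obtain k where "b13 = 13 ^ k" "k \<le> 1"
    using b'(3) divides_primepow_nat[OF p(3), of b13 1] by auto
  ultimately show ?thesis using that bd(1) b'(1) b3(1) by simp
qed

lemma c3_norm_1_mod_8_neq_D: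
  fixes t :: c3_ring
  shows "c3_norm (1 + 8 * t) \<noteq> 3 ^ 4 * 5 * 13 * 73 ^ m"
proof
  assume eq: "c3_norm (1 + 8 * t) = 3 ^ 4 * 5 * 13 * 73 ^ m"
  obtain a b c where t: "t = C3 a b c" by (cases t)
  \<comment> \<open>\<open>A\<close> is the augmentation of \<open>1 + 8 * t\<close>, and x + y
    omega its value at omega, of norm \<open>N\<close>.\<close>
  define A x y where "A = 1 + 8 * (a + b + c)" and "x = 1 + 8 * (a - c)" and "y = 8 * (b - c)"
  define N where "N = x\<^sup>2 - x * y + y\<^sup>2"
  have "c3_norm (1 + 8 * t) = A * N"
    by (simp add: c3_norm_eq t numeral_c3_ring c3_ring_defs c3_aug_def c3_quad_def A_def N_def
        x_def y_def algebra_simps)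
  with eq have AN: "A * N = 3 ^ 4 * 5 * 13 * 73 ^ m" by simp
  have "4 * N = (2 * x - y)\<^sup>2 + 3 * y\<^sup>2" by (simp add: N_def algebra_simps power2_eq_square)
  then have "0 \<le> N" by (smt (verit) zero_le_power2)
  have N8: "N mod 8 = 1"
  proof -
    have "N = 1 + 8 * (2 * (a - c) + 8 * (a - c)\<^sup>2 - x * (b - c) + 8 * (b - c)\<^sup>2)"
      by (simp add: N_def x_def y_def algebra_simps power2_eq_square)
    then show ?thesis by (simp only: mod_mult_self2) simp
  qed
  have A3: "A = x + y + 24 * c" by (simp add: A_def x_def y_def)
  have N3: "N = (x + y)\<^sup>2 - 3 * (x * y)" by (simp add: N_def algebra_simps power2_eq_square)
  \<comment> \<open>The values at 1 and omega agree modulo 1 - omega, so 3 divides both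
    \<open>A\<close> and \<open>N\<close> as soon as it divides their product. Hence the exponent of
    3 in \<open>N\<close> is neither 0 nor 4.\<close>
  have xy: "3 dvd x + y"
  proof -
    have "prime (3 :: int)" by simp
    moreover have "3 dvd A * N" unfolding AN by simp
    ultimately consider "3 dvd A" | "3 dvd N" using prime_dvd_mult_iff by blast
    then show ?thesis
    proof cases
      case 1
      then show ?thesis unfolding A3 by presburger
    next
      case 2
      then have "3 dvd (x + y)\<^sup>2" unfolding N3 by (simp add: dvd_diff_left_iff)
      then show ?thesis using \<open>prime 3\<close> prime_dvd_power by blast
    qed
  qed
  then have "3 dvd A" unfolding A3 by presburger
  have "3 dvd N" unfolding N3 using xy by (simp add: power2_eq_square)
  have "N dvd 3 ^ 4 * 5 * 13 * 73 ^ m" using AN by (metis dvd_triv_right)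
  then have "nat N dvd nat (3 ^ 4 * 5 * 13 * 73 ^ m)" using \<open>0 \<le> N\<close> by (simp add: nat_dvd_iff)
  also have "nat (3 ^ 4 * 5 * 13 * 73 ^ m) = 3 ^ 4 * 5 * 13 * 73 ^ m"
    by (simp add: nat_mult_distrib nat_power_eq)
  finally obtain i j k s where ijk: "nat N = 3 ^ i * 5 ^ j * 13 ^ k * 73 ^ s"
    "i \<le> 4" "j \<le> 1" "k \<le> 1" "s \<le> m"
    by (rule dvd_primes_3_5_13_73_cases)
  have "int (nat N) = int (3 ^ i * 5 ^ j * 13 ^ k * 73 ^ s)" by (simp only: ijk)
  then have N: "N = 3 ^ i * 5 ^ j * 13 ^ k * 73 ^ s" using \<open>0 \<le> N\<close> by simp
  define P :: int where "P = 73 ^ s"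
  have P8: "P mod 8 = 1" using power_mod[of "73 :: int" 8 s] by (simp add: P_def)
  have prime_3: "prime (3 :: int)" by simp
  have i: "i = 0 \<or> i = 1 \<or> i = 2 \<or> i = 3 \<or> i = 4" and jk: "j = 0 \<or> j = 1" "k = 0 \<or> k = 1"
    using ijk(2-4) by linarith+
  have "i \<noteq> 0"
  proof
    assume "i = 0"
    then have "3 dvd 5 ^ j * 13 ^ k * (73 :: int) ^ s" using \<open>3 dvd N\<close> N by simp
    then have "3 dvd (5 :: int) \<or> 3 dvd (13 :: int) \<or> 3 dvd (73 :: int)"
      using prime_3 by (meson prime_dvd_mult_iff prime_dvd_power)
    then show False by simp
  qed
  moreover have "i \<noteq> 4"
  proof
    assume "i = 4"
    then have "A * (5 ^ j * 13 ^ k * 73 ^ s) = 65 * 73 ^ m" using AN unfolding N by simp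
    then have "3 dvd 65 * (73 :: int) ^ m" using \<open>3 dvd A\<close> by (metis dvd_mult2)
    then have "3 dvd (65 :: int) \<or> 3 dvd (73 :: int)"
      using prime_3 by (meson prime_dvd_mult_iff prime_dvd_power)
    then show False by simp
  qed
  moreover have "(3 ^ i * 5 ^ j * 13 ^ k :: int) mod 8 = 1"
    using N8 P8 mod_mult_right_eq[of "3 ^ i * 5 ^ j * 13 ^ k" P 8] by (simp add: N P_def)
  \<comment> \<open>Modulo 8 both 5 and 13 are 5; an odd \<open>i\<close> would leave 3 or 7, and
    for \<open>i = 2\<close> the powers of 5 must cancel.\<close>
  ultimately have "i = 2 \<and> j = k" using i jk by auto
  then have "N = 9 * P \<or> N = 585 * P" using jk by (auto simp: N P_def)
  moreover have "N \<noteq> 585 * P"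
  proof
    assume N': "N = 585 * P"
    then have "5 dvd N" by simp
    then have "25 dvd 585 * P" using five_dvd_eisenstein_norm[of x y] N' unfolding N_def by simp
    then obtain l where "585 * P = 25 * l" ..
    then have "117 * P = 5 * l" by simp
    then have "5 dvd 117 * P" by simp
    moreover have "prime (5 :: int)" by simp
    ultimately have "5 dvd (117 :: int) \<or> 5 dvd (73 :: int)"
      unfolding P_def using prime_dvd_mult_iff prime_dvd_power by blast
    then show False by simp
  qed
  ultimately have N9: "N = 9 * 73 ^ s" by (simp add: P_def)
  then have "9 dvd x\<^sup>2 - x * y + y\<^sup>2" by (simp add: N_def)
  then obtain u v where uv: "x = 3 * u" "y = 3 * v"
    using nine_dvd_eisenstein_norm xy by (meson dvdE)
  have "9 * (u\<^sup>2 - u * v + v\<^sup>2) = N" by (simp add: N_def uv algebra_simps power2_eq_square)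
  then have "u\<^sup>2 - u * v + v\<^sup>2 = 73 ^ s" using N9 by simp
  from eisenstein_norm_power_73[OF this] have "u mod 8 \<noteq> 3" by auto
  \<comment> \<open>\<open>3 * u = x\<close> is 1 modulo 8, and 3 is its own inverse modulo
    8.\<close>
  moreover have "u mod 8 = 3"
  proof -
    have "3 * u = 1 + 8 * (a - c)" using uv x_def by simp
    then have "u = 3 + 8 * (3 * (a - c) - u)" by simp
    then have "u mod 8 = (3 + 8 * (3 * (a - c) - u)) mod 8" by (rule arg_cong)
    then show ?thesis by (simp only: mod_mult_self2) simp
  qed
  ultimately show False by simp
qed

section \<open>Determinants in terms of norms from the group ring of \<open>C\<^sub>3\<close>\<close>

lemma c3_eval_one: "c3_eval w 1 = 1"
  by (simp add: c3_eval_def one_c3_ring_def)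

lemma c3_eval_zero: "c3_eval w 0 = 0"
  by (simp add: c3_eval_def zero_c3_ring_def)

lemma c3_eval_uminus: "c3_eval w (- x) = - c3_eval w x"
  by (simp add: c3_eval_def uminus_c3_ring_def)

lemma c3_eval_power: "w ^ 3 = 1 \<Longrightarrow> c3_eval w (x ^ n) = c3_eval w x ^ n"
  by (induction n) (simp_all add: c3_eval_one c3_eval_mult)

lemma c3_eval_sum: "c3_eval w (\<Sum>i\<in>A. f i) = (\<Sum>i\<in>A. c3_eval w (f i))"
  by (induction A rule: infinite_finite_induct) (simp_all add: c3_eval_zero c3_eval_add)

lemmas c3_eval_hom = c3_eval_one c3_eval_zero c3_eval_uminus c3_eval_add c3_eval_diff
  c3_eval_sum c3_eval_mult c3_eval_power

lemma lessThan_unfold: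
  "{..<2} = {0, 1::nat}" "{..<6} = {0, 1, 2, 3, 4, 5::nat}"
  "{..<12} = {0, 1, 2, 3, 4, 5, 6, 7, 8, 9, 10, 11::nat}"
  by (auto simp: lessThan_nat_numeral lessThan_Suc)

text \<open>The indices of \<open>f\<close> are sorted by their residues modulo \<open>2\<close> (resp. \<open>4\<close>) and \<open>3\<close>, following
  \<open>C\<^sub>6 = C\<^sub>2 \<times> C\<^sub>3\<close> and \<open>C\<^sub>1\<^sub>2 = C\<^sub>4 \<times> C\<^sub>3\<close>.\<close>

lemma sum_power_mult_6:
  fixes s w :: complex and f :: "nat \<Rightarrow> int"
  assumes "s ^ 2 = 1" "w ^ 3 = 1"
  shows "(\<Sum>k<6. of_int (f k) * (s * w) ^ k)
    = c3_eval w (C3 (f 0) (f 4) (f 2)) + s * c3_eval w (C3 (f 3) (f 1) (f 5))"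
proof -
  have s: "s ^ 3 = s" "s ^ 4 = 1" "s ^ 5 = s"
    using power_mod_exponent[OF assms(1), of 3] power_mod_exponent[OF assms(1), of 4]
      power_mod_exponent[OF assms(1), of 5] by simp_all
  have w: "w ^ 4 = w" "w ^ 5 = w ^ 2"
    using power_mod_exponent[OF assms(2), of 4] power_mod_exponent[OF assms(2), of 5] by simp_all
  show ?thesis
    by (simp add: lessThan_unfold power_mult_distrib assms s w c3_eval_def algebra_simps)
qed

lemma sum_power_mult_12:
  fixes s w :: complex and f :: "nat \<Rightarrow> int"
  assumes "s ^ 4 = 1" "w ^ 3 = 1"
  shows "(\<Sum>k<12. of_int (f k) * (s * w) ^ k)
    = c3_eval w (C3 (f 0) (f 4) (f 8)) + s * c3_eval w (C3 (f 9) (f 1) (f 5))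
      + s ^ 2 * c3_eval w (C3 (f 6) (f 10) (f 2)) + s ^ 3 * c3_eval w (C3 (f 3) (f 7) (f 11))"
proof -
  have s: "s ^ 5 = s" "s ^ 6 = s ^ 2" "s ^ 7 = s ^ 3" "s ^ 8 = 1" "s ^ 9 = s" "s ^ 10 = s ^ 2"
    "s ^ 11 = s ^ 3"
    using power_mod_exponent[OF assms(1), of 5] power_mod_exponent[OF assms(1), of 6]
      power_mod_exponent[OF assms(1), of 7] power_mod_exponent[OF assms(1), of 8]
      power_mod_exponent[OF assms(1), of 9] power_mod_exponent[OF assms(1), of 10]
      power_mod_exponent[OF assms(1), of 11] by simp_all
  have w: "w ^ 4 = w" "w ^ 5 = w ^ 2" "w ^ 6 = 1" "w ^ 7 = w" "w ^ 8 = w ^ 2" "w ^ 9 = 1"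
    "w ^ 10 = w" "w ^ 11 = w ^ 2"
    using power_mod_exponent[OF assms(2), of 4] power_mod_exponent[OF assms(2), of 5]
      power_mod_exponent[OF assms(2), of 6] power_mod_exponent[OF assms(2), of 7]
      power_mod_exponent[OF assms(2), of 8] power_mod_exponent[OF assms(2), of 9]
      power_mod_exponent[OF assms(2), of 10] power_mod_exponent[OF assms(2), of 11] by simp_all
  show ?thesis
    by (simp add: lessThan_unfold power_mult_distrib assms s w c3_eval_def algebra_simps)
qed

lemma omega_powers:
  "omega ^ 4 = omega" "omega ^ 5 = omega ^ 2" "omega ^ 6 = 1" "omega ^ 7 = omega"
  "omega ^ 8 = omega ^ 2" "omega ^ 9 = 1" "omega ^ 10 = omega" "omega ^ 11 = omega ^ 2"
  using power_mod_exponent[OF omega_cube, of 4] power_mod_exponent[OF omega_cube, of 5]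
    power_mod_exponent[OF omega_cube, of 6] power_mod_exponent[OF omega_cube, of 7]
    power_mod_exponent[OF omega_cube, of 8] power_mod_exponent[OF omega_cube, of 9]
    power_mod_exponent[OF omega_cube, of 10] power_mod_exponent[OF omega_cube, of 11] omega_cube
  by simp_all

lemma i_powers:
  "\<i> ^ 3 = - \<i>" "\<i> ^ 4 = 1" "\<i> ^ 5 = \<i>" "\<i> ^ 6 = - 1" "\<i> ^ 7 = - \<i>" "\<i> ^ 8 = 1"
  "\<i> ^ 9 = \<i>" "\<i> ^ 10 = - 1" "\<i> ^ 11 = - \<i>"
  by (simp_all add: numeral_eq_Suc)

text \<open>By the Chinese remainder theorem each pair of a sign and a cube root of unity occurs for
  exactly one \<open>l\<close>.\<close>

lemma prod_powers_6:
  fixes \<Phi> :: "complex \<Rightarrow> complex \<Rightarrow> complex"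
  shows "(\<Prod>l<6. \<Phi> ((- 1) ^ l) (omega ^ l))
    = (\<Prod>w\<in>{1, omega, omega ^ 2}. \<Phi> 1 w * \<Phi> (- 1) w)"
  by (simp add: omega_neq omega_neq[symmetric] lessThan_unfold omega_powers omega_cube ac_simps)

lemma prod_powers_12:
  fixes \<Phi> :: "complex \<Rightarrow> complex \<Rightarrow> complex"
  shows "(\<Prod>l<12. \<Phi> (\<i> ^ l) (omega ^ l))
    = (\<Prod>w\<in>{1, omega, omega ^ 2}. \<Phi> 1 w * \<Phi> (- 1) w * (\<Phi> \<i> w * \<Phi> (- \<i>) w))"
  by (simp add: omega_neq omega_neq[symmetric] lessThan_unfold omega_powers omega_cube i_powers ac_simps)

lemma prod_c3_eval: "(\<Prod>w\<in>{1, omega, omega ^ 2}. c3_eval w x) = of_int (c3_norm x)"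
  by (simp add: omega_neq omega_neq[symmetric] c3_norm_eval mult.assoc)

lemma pairing_2: "group_pairing (\<lambda>g k :: 2. (- 1) ^ (residue g * residue k))"
proof (rule group_pairing_bit0)
  fix k :: nat assume "0 < k" "k < CARD(2)"
  then have "k = 1" by simp
  then show "(- 1 :: complex) ^ k \<noteq> 1" by simp
qed simp

text \<open>Taking (-1) omega as the primitive sixth root, and i omega as the primitive twelfth root
  below, separates the 2-part of each character from its 3-part.\<close>

lemma pairing_6: "group_pairing (\<lambda>g k :: 6. (- omega) ^ (residue g * residue k))"
proof (rule group_pairing_bit0)
  fix k :: nat assume "0 < k" "k < CARD(6)"
  then have "k \<in> {1, 2, 3, 4, 5}" by auto
  then show "(- omega) ^ k \<noteq> 1"
    by (auto simp: omega_powers omega_cube omega_square power_minus_odd)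
      (auto simp: omega_def complex_eq_iff)
qed (simp add: omega_powers)

lemma pairing_12: "group_pairing (\<lambda>g k :: 12. (\<i> * omega) ^ (residue g * residue k))"
proof (rule group_pairing_bit0)
  have "omega ^ 12 = (omega ^ 3) ^ 4" "\<i> ^ 12 = (\<i> ^ 4) ^ 3" by (simp_all flip: power_mult)
  then show "(\<i> * omega) ^ CARD(12) = 1"
    by (simp add: power_mult_distrib omega_cube)
  fix k :: nat assume "0 < k" "k < CARD(12)"
  then have "k \<in> {1, 2, 3, 4, 5, 6, 7, 8, 9, 10, 11}" by simp presburger
  then show "(\<i> * omega) ^ k \<noteq> 1"
    by (auto simp: power_mult_distrib omega_powers omega_cube omega_square i_powers)
      (auto simp: omega_def complex_eq_iff)
qed

lemma sum_UNIV_prod: "(\<Sum>x\<in>UNIV. f x) = (\<Sum>a\<in>UNIV. \<Sum>b\<in>UNIV. f (a, b))"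
  by (simp add: sum.cartesian_product flip: UNIV_Times_UNIV)

lemma prod_UNIV_prod: "(\<Prod>x\<in>UNIV. f x) = (\<Prod>a\<in>UNIV. \<Prod>b\<in>UNIV. f (a, b))"
  by (simp add: prod.cartesian_product flip: UNIV_Times_UNIV)

text \<open>The 24 characters are grouped by their restriction to C_2^3; for each restriction the
  three cube roots of unity contribute one norm. \<open>h\<close> and \<open>i\<close> index
  characters of the first two factors, and the sum and the difference belong to the C_2 inside
  C_6.\<close>

lemma det_group_matrix_C2_C2_C6:
  fixes a :: "2 \<times> 2 \<times> 6 \<Rightarrow> int"
  obtains c :: "nat \<Rightarrow> nat \<Rightarrow> nat \<Rightarrow> c3_ring" where
    "det (group_matrix a) = c3_norm (\<Prod>h<2. \<Prod>i<2.
      (\<Sum>h'<2. \<Sum>i'<2. (- 1) ^ (h' * h) * (- 1) ^ (i' * i) * (c h' i' 0 + c h' i' 1)) *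
      (\<Sum>h'<2. \<Sum>i'<2. (- 1) ^ (h' * h) * (- 1) ^ (i' * i) * (c h' i' 0 - c h' i' 1)))"
proof -
  define f where "f h i k = a (of_nat h, of_nat i, of_nat k)" for h i k
  define c where "c h i b = (if b = (0::nat) then C3 (f h i 0) (f h i 4) (f h i 2)
    else C3 (f h i 3) (f h i 1) (f h i 5))" for h i b
  define X where "X h i b = (\<Sum>h'<2. \<Sum>i'<2. (- 1) ^ (h' * h) * (- 1) ^ (i' * i) * c h' i' b)" for h i b
  define Q where "Q h i = (X h i 0 + X h i 1) * (X h i 0 - X h i 1)" for h i
  have w3: "w ^ 3 = 1" if "w \<in> {1, omega, omega ^ 2}" for w
    using that omega_cube omega_square_cube by auto
  have inner: "(\<Sum>k<6. of_int (f h i k) * (- omega) ^ (k * l))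
      = c3_eval (omega ^ l) (c h i 0) + (- 1) ^ l * c3_eval (omega ^ l) (c h i 1)" for h i l
  proof -
    have "((- 1 :: complex) ^ l) ^ 2 = 1" by (simp flip: power_mult)
    moreover have "(omega ^ l) ^ 3 = (omega ^ 3) ^ l" by (simp flip: power_mult add: mult.commute)
    then have "(omega ^ l) ^ 3 = 1" by (simp add: omega_cube)
    moreover have "(- omega) ^ (k * l) = ((- 1) ^ l * omega ^ l) ^ k" for k
      by (metis mult.commute mult_minus1 power_mult power_mult_distrib)
    ultimately show ?thesis by (simp only: sum_power_mult_6) (simp add: c_def)
  qed
  define \<Psi> where "\<Psi> h i s w = (\<Sum>h'<2. \<Sum>i'<2. (- 1) ^ (h' * h) * (- 1) ^ (i' * i)
      * (c3_eval w (c h' i' 0) + s * c3_eval w (c h' i' 1)))" for h i and s w :: complex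
  have \<Psi>: "\<Psi> h i 1 w = c3_eval w (X h i 0 + X h i 1)"
    "\<Psi> h i (- 1) w = c3_eval w (X h i 0 - X h i 1)" if "w ^ 3 = 1" for h i w
    using that by (simp_all add: \<Psi>_def X_def c3_eval_hom sum.distrib sum_subtractf algebra_simps)
  have "of_int (det (group_matrix a)) = (\<Prod>k\<in>(UNIV :: (2 \<times> 2 \<times> 6) set). \<Sum>g\<in>UNIV. of_int (a g) *
    ((- 1) ^ (residue (fst g) * residue (fst k)) * ((- 1) ^ (residue (fst (snd g)) * residue (fst (snd k)))
      * (- omega) ^ (residue (snd (snd g)) * residue (snd (snd k))))))"
    using det_int_group_matrix_pairing[OF group_pairing_prod[OF pairing_2
          group_pairing_prod[OF pairing_2 pairing_6]], of a] by simp
  also have "\<dots> = (\<Prod>h<2. \<Prod>i<2. \<Prod>l<6. \<Sum>h'<2. \<Sum>i'<2. \<Sum>k<6. of_int (f h' i' k) *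
    ((- 1) ^ (h' * h) * ((- 1) ^ (i' * i) * (- omega) ^ (k * l))))"
    unfolding prod_UNIV_prod sum_UNIV_prod fst_conv snd_conv prod_bit0 sum_bit0
    by (auto intro!: prod.cong sum.cong simp: residue_of_nat f_def)
  also have "\<dots> = (\<Prod>h<2. \<Prod>i<2. \<Prod>l<6. \<Psi> h i ((- 1) ^ l) (omega ^ l))"
    unfolding \<Psi>_def inner[symmetric] by (simp add: sum_distrib_left ac_simps)
  also have "\<dots> = (\<Prod>h<2. \<Prod>i<2. \<Prod>w\<in>{1, omega, omega ^ 2}. c3_eval w (Q h i))"
    unfolding prod_powers_6 by (intro prod.cong refl) (simp add: w3 \<Psi> Q_def c3_eval_mult)
  also have "\<dots> = of_int (\<Prod>h<2. \<Prod>i<2. c3_norm (Q h i))"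
    unfolding prod_c3_eval by simp
  finally have "det (group_matrix a) = (\<Prod>h<2. \<Prod>i<2. c3_norm (Q h i))"
    by (simp only: of_int_eq_iff)
  also have "\<dots> = c3_norm (\<Prod>h<2. \<Prod>i<2. Q h i)"
    by (simp add: lessThan_unfold c3_norm_mult)
  finally show ?thesis
    by (intro that[of c])
      (simp add: Q_def X_def distrib_left right_diff_distrib sum.distrib sum_subtractf)
qed

definition c3_coeff :: "c3_ring \<Rightarrow> nat \<Rightarrow> int" where
  "c3_coeff x j = (if j = 0 then c3_0 x else if j = 1 then c3_1 x else c3_2 x)"

text \<open>Any eight ring elements \<open>c h m\<close> may serve as the coefficients on C_2 x C_4.
  \<open>p\<close> and \<open>q\<close> come from the two characters of C_2, and each sum of two
  squares is the product of the values at the characters of C_4 sending a generator to i and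
  -i.\<close>

lemma c3_norm_in_group_det_set_C2_C12:
  fixes p q :: "nat \<Rightarrow> c3_ring" and c :: "nat \<Rightarrow> nat \<Rightarrow> c3_ring"
  defines "p m \<equiv> c 0 m + c 1 m" and "q m \<equiv> c 0 m - c 1 m"
  shows "c3_norm (((p 0 + p 1 + p 2 + p 3) * (p 0 - p 1 + p 2 - p 3) * ((p 0 - p 2)\<^sup>2 + (p 1 - p 3)\<^sup>2)) *
    ((q 0 + q 1 + q 2 + q 3) * (q 0 - q 1 + q 2 - q 3) * ((q 0 - q 2)\<^sup>2 + (q 1 - q 3)\<^sup>2)))
    \<in> group_det_set TYPE(2 \<times> 12)"
proof -
  \<comment> \<open>Inverts the sorting of indices in \<open>sum_power_mult_12\<close>:
    \<open>k\<close> is recovered from its residues modulo 4 and 3.\<close>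
  define f where "f h k = c3_coeff (c h (k mod 4)) (k mod 3)" for h k :: nat
  define a :: "2 \<times> 12 \<Rightarrow> int" where "a x = f (residue (fst x)) (residue (snd x))" for x
  define X where "X h m = (\<Sum>h'<2. (- 1) ^ (h' * h) * c h' m)" for h m :: nat
  define Q where "Q h = (X h 0 + X h 1 + X h 2 + X h 3) * (X h 0 - X h 1 + X h 2 - X h 3)
    * ((X h 0 - X h 2)\<^sup>2 + (X h 1 - X h 3)\<^sup>2)" for h
  have w3: "w ^ 3 = 1" if "w \<in> {1, omega, omega ^ 2}" for w
    using that omega_cube omega_square_cube by auto
  have inner: "(\<Sum>k<12. of_int (f h k) * (\<i> * omega) ^ (k * l))
      = c3_eval (omega ^ l) (c h 0) + \<i> ^ l * c3_eval (omega ^ l) (c h 1)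
        + (\<i> ^ l) ^ 2 * c3_eval (omega ^ l) (c h 2) + (\<i> ^ l) ^ 3 * c3_eval (omega ^ l) (c h 3)" for h l
  proof -
    have "(\<i> ^ l) ^ 4 = (\<i> ^ 4) ^ l" by (simp flip: power_mult add: mult.commute)
    then have "(\<i> ^ l) ^ 4 = 1" by simp
    moreover have "(omega ^ l) ^ 3 = (omega ^ 3) ^ l" by (simp flip: power_mult add: mult.commute)
    then have "(omega ^ l) ^ 3 = 1" by (simp add: omega_cube)
    moreover have "(\<i> * omega) ^ (k * l) = (\<i> ^ l * omega ^ l) ^ k" for k
      by (metis mult.commute power_mult power_mult_distrib)
    ultimately show ?thesis
      by (simp only: sum_power_mult_12) (simp add: f_def c3_coeff_def)
  qed
  define \<Psi> where "\<Psi> h s w = (\<Sum>h'<2. (- 1) ^ (h' * h) * (c3_eval w (c h' 0) + s * c3_eval w (c h' 1)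
        + s ^ 2 * c3_eval w (c h' 2) + s ^ 3 * c3_eval w (c h' 3)))" for h and s w :: complex
  have \<Psi>: "\<Psi> h s w = c3_eval w (X h 0) + s * c3_eval w (X h 1) + s ^ 2 * c3_eval w (X h 2)
    + s ^ 3 * c3_eval w (X h 3)" if "w ^ 3 = 1" for h s w
    using that by (simp add: \<Psi>_def X_def c3_eval_hom sum.distrib sum_distrib_left algebra_simps)
  have \<Psi>Q: "\<Psi> h 1 w * \<Psi> h (- 1) w * (\<Psi> h \<i> w * \<Psi> h (- \<i>) w) = c3_eval w (Q h)"
    if "w ^ 3 = 1" for h w
  proof -
    have i: "(x + \<i> * y + \<i> ^ 2 * z + \<i> ^ 3 * t) * (x + - \<i> * y + (- \<i>) ^ 2 * z + (- \<i>) ^ 3 * t)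
      = (x - z) ^ 2 + (y - t) ^ 2" for x y z t
    proof -
      have "x + \<i> * y + \<i> ^ 2 * z + \<i> ^ 3 * t = (x - z) + \<i> * (y - t)"
        "x + - \<i> * y + (- \<i>) ^ 2 * z + (- \<i>) ^ 3 * t = (x - z) - \<i> * (y - t)"
        by (simp_all add: i_powers power_minus_odd algebra_simps)
      moreover have "(r + \<i> * s) * (r - \<i> * s) = r ^ 2 + s ^ 2" for r s
        by (simp add: power2_eq_square algebra_simps)
      ultimately show ?thesis by (simp only:)
    qed
    have 1: "x + 1 * y + 1 ^ 2 * z + 1 ^ 3 * t = x + y + z + t"
      "x + - 1 * y + (- 1) ^ 2 * z + (- 1) ^ 3 * t = x - y + z - t" for x y z t :: complex
      by simp_all
    show ?thesis
      by (simp only: \<Psi>[OF that] i 1 Q_def c3_eval_hom that)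
  qed
  have "of_int (det (group_matrix a)) = (\<Prod>k\<in>(UNIV :: (2 \<times> 12) set). \<Sum>g\<in>UNIV. of_int (a g) *
    ((- 1) ^ (residue (fst g) * residue (fst k)) * (\<i> * omega) ^ (residue (snd g) * residue (snd k))))"
    using det_int_group_matrix_pairing[OF group_pairing_prod[OF pairing_2 pairing_12], of a] by simp
  also have "\<dots> = (\<Prod>h<2. \<Prod>l<12. \<Sum>h'<2. \<Sum>k<12. of_int (f h' k) *
    ((- 1) ^ (h' * h) * (\<i> * omega) ^ (k * l)))"
    unfolding prod_UNIV_prod sum_UNIV_prod fst_conv snd_conv prod_bit0 sum_bit0
    by (auto intro!: prod.cong sum.cong simp: residue_of_nat a_def)
  also have "\<dots> = (\<Prod>h<2. \<Prod>l<12. \<Psi> h (\<i> ^ l) (omega ^ l))"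
    unfolding \<Psi>_def inner[symmetric] by (simp add: sum_distrib_left ac_simps)
  also have "\<dots> = (\<Prod>h<2. \<Prod>w\<in>{1, omega, omega ^ 2}. c3_eval w (Q h))"
    unfolding prod_powers_12 by (intro prod.cong refl) (simp add: w3 \<Psi>Q)
  also have "\<dots> = of_int (\<Prod>h<2. c3_norm (Q h))"
    unfolding prod_c3_eval by simp
  finally have "det (group_matrix a) = (\<Prod>h<2. c3_norm (Q h))"
    by (simp only: of_int_eq_iff)
  also have "\<dots> = c3_norm (Q 0 * Q 1)"
    by (simp add: lessThan_unfold c3_norm_mult)
  also have "X 0 m = p m" "X 1 m = q m" for m
    by (simp_all add: X_def p_def q_def lessThan_unfold)
  then have "Q 0 * Q 1 = ((p 0 + p 1 + p 2 + p 3) * (p 0 - p 1 + p 2 - p 3) * ((p 0 - p 2)\<^sup>2 + (p 1 - p 3)\<^sup>2)) *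
    ((q 0 + q 1 + q 2 + q 3) * (q 0 - q 1 + q 2 - q 3) * ((q 0 - q 2)\<^sup>2 + (q 1 - q 3)\<^sup>2))"
    by (simp only: Q_def)
  finally show ?thesis unfolding group_det_set_def by (metis (mono_tags, lifting) mem_Collect_eq)
qed

section \<open>Odd determinants\<close>

lemma eight_dvd_det_C2_C2_C6:
  fixes c :: "nat \<Rightarrow> nat \<Rightarrow> nat \<Rightarrow> 'a::comm_ring_1"
  shows "8 dvd (\<Prod>h<2. \<Prod>i<2.
      (\<Sum>h'<2. \<Sum>i'<2. (- 1) ^ (h' * h) * (- 1) ^ (i' * i) * (c h' i' 0 + c h' i' 1)) *
      (\<Sum>h'<2. \<Sum>i'<2. (- 1) ^ (h' * h) * (- 1) ^ (i' * i) * (c h' i' 0 - c h' i' 1)))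
    - (c 0 0 0 + c 1 0 0 + c 0 1 0 + c 1 1 0 + c 0 0 1 + c 1 0 1 + c 0 1 1 + c 1 1 1) ^ 8"
proof -
  define p m where
    "p h i = (\<Sum>h'<2. \<Sum>i'<2. (- 1) ^ (h' * h) * (- 1) ^ (i' * i) * (c h' i' 0 + c h' i' 1))"
    and "m h i = (\<Sum>h'<2. \<Sum>i'<2. (- 1) ^ (h' * h) * (- 1) ^ (i' * i) * (c h' i' 0 - c h' i' 1))"
    for h i :: nat
  have signs:
    "c 0 0 0 + c 1 0 0 + c 0 1 0 + c 1 1 0 + c 0 0 1 + c 1 0 1 + c 0 1 1 + c 1 1 1 = p 0 0"
    "c 0 0 0 - c 1 0 0 + c 0 1 0 - c 1 1 0 + c 0 0 1 - c 1 0 1 + c 0 1 1 - c 1 1 1 = p 1 0"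
    "c 0 0 0 + c 1 0 0 - c 0 1 0 - c 1 1 0 + c 0 0 1 + c 1 0 1 - c 0 1 1 - c 1 1 1 = p 0 1"
    "c 0 0 0 - c 1 0 0 - c 0 1 0 + c 1 1 0 + c 0 0 1 - c 1 0 1 - c 0 1 1 + c 1 1 1 = p 1 1"
    "c 0 0 0 + c 1 0 0 + c 0 1 0 + c 1 1 0 - c 0 0 1 - c 1 0 1 - c 0 1 1 - c 1 1 1 = m 0 0"
    "c 0 0 0 - c 1 0 0 + c 0 1 0 - c 1 1 0 - c 0 0 1 + c 1 0 1 - c 0 1 1 + c 1 1 1 = m 1 0"
    "c 0 0 0 + c 1 0 0 - c 0 1 0 - c 1 1 0 - c 0 0 1 - c 1 0 1 + c 0 1 1 + c 1 1 1 = m 0 1"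
    "c 0 0 0 - c 1 0 0 - c 0 1 0 + c 1 1 0 - c 0 0 1 + c 1 0 1 + c 0 1 1 - c 1 1 1 = m 1 1"
    by (simp_all add: p_def m_def lessThan_unfold algebra_simps)
  have "8 dvd p 0 0 * p 1 0 * (p 0 1 * p 1 1) * (m 0 0 * m 1 0 * (m 0 1 * m 1 1)) - p 0 0 ^ 8"
    using eight_dvd_sign_product[of "c 0 0 0" "c 1 0 0" "c 0 1 0" "c 1 1 0" "c 0 0 1" "c 1 0 1"
        "c 0 1 1" "c 1 1 1"] unfolding signs .
  moreover have "p 0 0 * p 1 0 * (p 0 1 * p 1 1) * (m 0 0 * m 1 0 * (m 0 1 * m 1 1))
      = (\<Prod>h<2. \<Prod>i<2. p h i * m h i)"
    by (simp add: lessThan_unfold ac_simps)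
  ultimately show ?thesis unfolding signs p_def m_def by simp
qed

text \<open>Modulo 2 the norm is a + b + c + abc, which is odd exactly when one coefficient is odd
  and the other two are even; \<open>u\<close> is the corresponding element of C_3.\<close>

lemma odd_c3_norm_cases:
  assumes "odd (c3_norm x)"
  obtains u w where "x = u + 2 * w" "u ^ 3 = 1" "c3_norm u = 1"
proof -
  obtain a b c where x: "x = C3 a b c" by (cases x)
  have half: "2 * (n div 2) = n" if "even n" for n :: int using that by simp
  have half': "1 + 2 * (n div 2) = n" if "odd n" for n :: int using that by presburger
  define w where "w = C3 (a div 2) (b div 2) (c div 2)"
  consider "odd a" "even b" "even c" | "even a" "odd b" "even c" | "even a" "even b" "odd c"
    using assms by (auto simp: x c3_norm_C3)
  then show ?thesis
  proof cases
    case 1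
    then show ?thesis
      by (intro that[of 1 w])
        (auto simp: x w_def numeral_c3_ring c3_ring_defs c3_norm_def half half' power3_eq_cube)
  next
    case 2
    then show ?thesis
      by (intro that[of "C3 0 1 0" w])
        (auto simp: x w_def numeral_c3_ring c3_ring_defs c3_norm_def half half' power3_eq_cube)
  next
    case 3
    then show ?thesis
      by (intro that[of "C3 0 0 1" w])
        (auto simp: x w_def numeral_c3_ring c3_ring_defs c3_norm_def half half' power3_eq_cube)
  qed
qed

lemma odd_c3_norm_add_even: "odd (c3_norm (x + 2 * y)) \<longleftrightarrow> odd (c3_norm x)"
  by (simp add: c3_norm_def numeral_c3_ring plus_c3_ring_def times_c3_ring_def)

text \<open>The first two squarings improve the congruence from modulo 2 to modulo 4 and then modulo
  8; the third keeps it.\<close>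

lemma eight_dvd_power_8:
  fixes u :: "'a::comm_ring_1"
  shows "8 dvd (u + 2 * w) ^ 8 - u ^ 8"
proof -
  have "(u + 2 * w) ^ 8 = (((u + 2 * w) ^ 2) ^ 2) ^ 2" by (simp flip: power_mult)
  also have "(u + 2 * w) ^ 2 = u ^ 2 + 4 * (u * w + w ^ 2)"
    by (simp add: power2_eq_square algebra_simps)
  also have "(x + 4 * y) ^ 2 = x ^ 2 + 8 * (x * y + 2 * y ^ 2)" for x y :: 'a
    by (simp add: power2_eq_square algebra_simps)
  also have "(x + 8 * y) ^ 2 = x ^ 2 + 8 * (2 * x * y + 8 * y ^ 2)" for x y :: 'a
    by (simp add: power2_eq_square algebra_simps)
  finally obtain k where "(u + 2 * w) ^ 8 = ((u ^ 2) ^ 2) ^ 2 + 8 * k" by blast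
  then show ?thesis by (simp flip: power_mult)
qed

lemma odd_group_det_C2_C2_C6:
  assumes "d \<in> odd_group_det_set TYPE(2 \<times> 2 \<times> 6)"
  obtains t where "d = c3_norm (1 + 8 * t)"
proof -
  from assms obtain a :: "2 \<times> 2 \<times> 6 \<Rightarrow> int" where a: "d = det (group_matrix a)" and "odd d"
    by (auto simp: odd_group_det_set_def group_det_set_def)
  obtain Q e where Q: "d = c3_norm Q" "8 dvd Q - e ^ 8"
  proof (rule det_group_matrix_C2_C2_C6[of a])
    fix c :: "nat \<Rightarrow> nat \<Rightarrow> nat \<Rightarrow> c3_ring"
    assume "det (group_matrix a) = c3_norm (\<Prod>h<2. \<Prod>i<2.
      (\<Sum>h'<2. \<Sum>i'<2. (- 1) ^ (h' * h) * (- 1) ^ (i' * i) * (c h' i' 0 + c h' i' 1)) *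
      (\<Sum>h'<2. \<Sum>i'<2. (- 1) ^ (h' * h) * (- 1) ^ (i' * i) * (c h' i' 0 - c h' i' 1)))"
    from that[OF a[unfolded this] eight_dvd_det_C2_C2_C6] show thesis .
  qed
  from Q(2) obtain s where "Q - e ^ 8 = 8 * s" ..
  then have s: "Q = e ^ 8 + 8 * s" by (simp add: diff_eq_eq)
  have "Q = e ^ 8 + 2 * (4 * s)" by (simp add: s mult.assoc[symmetric])
  then have "odd (c3_norm (e ^ 8))" using \<open>odd d\<close> Q(1) odd_c3_norm_add_even by metis
  then have "odd (c3_norm e)" by (simp add: c3_norm_power)
  then obtain u w where u: "e = u + 2 * w" "u ^ 3 = 1" "c3_norm u = 1"
    by (rule odd_c3_norm_cases)
  from eight_dvd_power_8[of u w] obtain v where "e ^ 8 - u ^ 8 = 8 * v"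
    unfolding u(1) ..
  then have v: "e ^ 8 = u ^ 8 + 8 * v" by (simp add: diff_eq_eq)
  \<comment> \<open>Since \<open>u ^ 9 = 1\<close> and \<open>u\<close> has norm 1, multiplying by
    \<open>u\<close> turns the leading term \<open>u ^ 8\<close> into 1 without changing the
    determinant.\<close>
  have "u * u ^ 8 = (u ^ 3) ^ 3" by (simp flip: power_mult power_Suc)
  then have "u * Q = 1 + 8 * (u * (v + s))" by (simp add: s v u(2) algebra_simps)
  moreover have "d = c3_norm (u * Q)" by (simp add: Q(1) c3_norm_mult u(3))
  ultimately show ?thesis using that by metis
qed

section \<open>Realizing determinants for C_2 x C_12\<close>

lemma c3_norm_1_mod_8_in_group_det_set_C2_C12:
  "c3_norm (1 + 8 * t) \<in> group_det_set TYPE(2 \<times> 12)"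
proof -
  \<comment> \<open>The constant part \<open>t\<close> is seen only by the trivial character of C_2
    x C_4; the other seven values are 1.\<close>
  define c where "c h m = t + (if h = 0 \<and> m = 0 then 1 else 0)" for h m :: nat
  have "((c 0 0 + c 1 0) + (c 0 1 + c 1 1) + (c 0 2 + c 1 2) + (c 0 3 + c 1 3)) = 1 + 8 * t"
    by (simp add: c_def algebra_simps)
  then show ?thesis
    using c3_norm_in_group_det_set_C2_C12[of c] by (simp add: c_def algebra_simps)
qed

text \<open>The group ring element \<open>1 + z + x y + y\<^sup>3 - x y\<^sup>3\<close>, with \<open>x\<close>, \<open>y\<close>, \<open>z\<close> generators of
  the factors \<open>C\<^sub>2\<close>, \<open>C\<^sub>4\<close>, \<open>C\<^sub>3\<close>, has determinant \<open>D\<^sub>0\<close>. Its value \<open>2 + z\<close> at the trivial character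
  of \<open>C\<^sub>2 \<times> C\<^sub>4\<close> may be replaced by any element congruent to it modulo \<open>8\<close>.\<close>

lemma D_in_group_det_set_C2_C12:
  "3 ^ 4 * 5 * 13 * 73 ^ (r + 1) \<in> group_det_set TYPE(2 \<times> 12)"
proof -
  define z where "z = C3 0 1 0"
  have "8 dvd (1 - 8 * z) ^ r - 1" by (simp add: power_diff_1_eq)
  then obtain g where g: "(1 - 8 * z) ^ r - 1 = 8 * g" ..
  define w where "w = (1 - z ^ 2) * g"
  define c where "c h m = w + (if h = 0 \<and> m = 0 then 1 + z else if h = 1 \<and> m = 1 \<or> h = 0 \<and> m = 3 then 1
    else if h = 1 \<and> m = 3 then - 1 else 0)" for h m :: nat
  have coeffs: "c 0 0 + c 1 0 = 1 + z + 2 * w" "c 0 1 + c 1 1 = 1 + 2 * w" "c 0 2 + c 1 2 = 2 * w"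
    "c 0 3 + c 1 3 = 2 * w" "c 0 0 - c 1 0 = 1 + z" "c 0 1 - c 1 1 = - 1" "c 0 2 - c 1 2 = 0"
    "c 0 3 - c 1 3 = 2"
    by (simp_all add: c_def algebra_simps)
  \<comment> \<open>2 + z = (1 + z + z^2) + (1 - z^2). The second summand has augmentation 0 and the
    first vanishes at omega, so the factor \<open>(1 - 8 * z) ^ r\<close> keeps the augmentation 3
    and multiplies the norm at omega by 73^r. \<open>w\<close> is chosen to make \<open>T\<close>
    equal to \<open>2 + z + 8 * w\<close>.\<close>
  define T where "T = (1 + z + z ^ 2) + (1 - z ^ 2) * (1 - 8 * z) ^ r"
  have T: "1 + z + 2 * w + (1 + 2 * w) + 2 * w + 2 * w = T"
  proof -
    have "T = 2 + z + (1 - z ^ 2) * ((1 - 8 * z) ^ r - 1)" by (simp add: T_def algebra_simps)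
    then have "T = 2 + z + 8 * w" by (simp only: g w_def mult.left_commute)
    then show ?thesis by (simp add: algebra_simps)
  qed
  have aug: "c3_aug (1 - z ^ 2) = 0" "c3_aug (1 + z + z ^ 2) = 3"
    by (simp_all add: z_def c3_aug_def power2_eq_square c3_ring_defs)
  have "c3_aug T = 3"
    unfolding T_def by (subst c3_aug_add) (simp add: c3_aug_mult aug)
  moreover have "c3_quad (1 + z + z ^ 2 + x) = c3_quad x" for x
    by (simp add: z_def c3_quad_def power2_eq_square c3_ring_defs)
  moreover have "c3_quad (1 - z ^ 2) = 3" "c3_quad (1 - 8 * z) = 73"
    by (simp_all add: z_def c3_quad_def power2_eq_square c3_ring_defs numeral_c3_ring)
  ultimately have "c3_norm T = 9 * 73 ^ r"
    by (simp add: c3_norm_eq) (simp add: T_def c3_quad_mult c3_quad_power)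
  \<comment> \<open>The factors 5 and 13 * 73 come from the non-real characters of C_4.\<close>
  moreover have "c3_norm z = 1" "c3_norm (2 + z) = 9" "c3_norm ((1 + z) ^ 2 + 1) = 5"
    "c3_norm ((1 + z) ^ 2 + 3 ^ 2) = 13 * 73"
    by (simp_all add: z_def c3_norm_def power2_eq_square c3_ring_defs numeral_c3_ring)
  ultimately have "c3_norm (T * z * ((1 + z) ^ 2 + 1) * ((2 + z) * z * ((1 + z) ^ 2 + 3 ^ 2)))
      = 3 ^ 4 * 5 * 13 * 73 ^ (r + 1)"
    by (simp add: c3_norm_mult)
  then show ?thesis
    using c3_norm_in_group_det_set_C2_C12[of c] unfolding coeffs T by (simp add: algebra_simps)
qed

theorem theorem6p2:
  shows "odd_group_det_set TYPE(2 \<times> 2 \<times> 6) \<subset> odd_group_det_set TYPE(2 \<times> 12) \<and>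
    (\<forall>r::nat. (3 ^ 4 * 5 * 13 * 73 ^ (r + 1) :: int)
      \<in> odd_group_det_set TYPE(2 \<times> 12) - odd_group_det_set TYPE(2 \<times> 2 \<times> 6))"
proof -
  have D: "(3 ^ 4 * 5 * 13 * 73 ^ (r + 1) :: int)
      \<in> odd_group_det_set TYPE(2 \<times> 12) - odd_group_det_set TYPE(2 \<times> 2 \<times> 6)" for r
  proof
    show "3 ^ 4 * 5 * 13 * 73 ^ (r + 1) \<in> odd_group_det_set TYPE(2 \<times> 12)"
      using D_in_group_det_set_C2_C12[of r] by (simp add: odd_group_det_set_def)
    show "3 ^ 4 * 5 * 13 * 73 ^ (r + 1) \<notin> odd_group_det_set TYPE(2 \<times> 2 \<times> 6)"
      using c3_norm_1_mod_8_neq_D by (metis odd_group_det_C2_C2_C6)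
  qed
  have "odd_group_det_set TYPE(2 \<times> 2 \<times> 6) \<subseteq> odd_group_det_set TYPE(2 \<times> 12)"
  proof
    fix d assume d: "d \<in> odd_group_det_set TYPE(2 \<times> 2 \<times> 6)"
    then obtain t where "d = c3_norm (1 + 8 * t)" by (rule odd_group_det_C2_C2_C6)
    with d show "d \<in> odd_group_det_set TYPE(2 \<times> 12)"
      using c3_norm_1_mod_8_in_group_det_set_C2_C12[of t] by (simp add: odd_group_det_set_def)
  qed
  with D show ?thesis by blast
qed

end
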